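(* Let $n\geq 2$ and let $A=(a_{ij})_{1\leq i,j\leq n}\in M_n(\mathbb{R})$ be symmetric. Let $p\in\{1,\dots,n\}$ and $1\leq k\leq \binom{n}{p}$. If $\lambda(A)_{[p]}\in\Gamma_k\left(\binom{n}{p}\right)$, then $(a_{11},\dots,a_{nn})_{[p]}\in\Gamma_k\left(\binom{n}{p}\right)$ and $$S_k\big((a_{11},\dots,a_{nn})_{[p]}\big)\geq S_k\big(\lambda(A)_{[p]}\big).$$
   Context: $M_n(\mathbb{R})$ is the set of $n\times n$ real matrices. For $N\geq 1$, $\mu=(\mu_1,\dots,\mu_N)\in\mathbb{R}^N$ and $1\le j\le N$, $S_j(\mu)=\sum_{1\leq i_1<\cdots<i_j\leq N}\mu_{i_1}\cdots\mu_{i_j}$ is the $j$-th elementary symmetric function. For $1\le k\le N$, $\Gamma_k(N)=\{\mu\in\mathbb{R}^N : S_j(\mu)>0 \text{ for all } j=1,\dots,k\}$. For a symmetric matrix $A\in M_n(\mathbb{R})$, $\lambda(A)=(\lambda_1,\dots,\lambda_n)$ denotes its eigenvalues (with multiplicity). For $p\in\{1,\dots,n\}$ and $\lambda=(\lambda_1,\dots,\lambda_n)\in\mathbb{R}^n$, $\lambda_{[p]}$ denotes the point $\left(\lambda_{i_1}+\cdots+\lambda_{i_p}\right)_{1\leq i_1<\cdots<i_p\leq n}$ of $\mathbb{R}^{\binom{n}{p}}$, whose coordinates are indexed by the increasing $p$-tuples in $\{1,\dots,n\}$. *)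

theory Defs
  imports "Jordan_Normal_Form.Char_Poly" "HOL-Computational_Algebra.Polynomial"
begin

text \<open>
  A point of \<open>\<real>\<^sup>N\<close> is a family \<open>\<mu>\<close> of reals over a finite index set \<open>I\<close> with \<open>N = card I\<close>; values of
  \<open>\<mu>\<close> outside \<open>I\<close> are never used. An increasing \<open>j\<close>-tuple of indices is represented by the
  \<open>j\<close>-element set of its entries.
\<close>

definition elem_sym :: "'i set \<Rightarrow> nat \<Rightarrow> ('i \<Rightarrow> real) \<Rightarrow> real" where
  "elem_sym I j \<mu> = (\<Sum>J | J \<subseteq> I \<and> card J = j. \<Prod>i\<in>J. \<mu> i)"

definition garding_cone :: "'i set \<Rightarrow> nat \<Rightarrow> ('i \<Rightarrow> real) set" where
  "garding_cone I k = {\<mu>. \<forall>j\<in>{1..k}. elem_sym I j \<mu> > 0}"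

text \<open>
  The coordinates of \<open>\<lambda>\<^bsub>[p]\<^esub>\<close> are indexed by \<open>tuples n p\<close>, the increasing \<open>p\<close>-tuples in
  \<open>{0, \<dots>, n - 1}\<close>; the coordinate at \<open>T\<close> is \<open>tuple_sum xs T\<close>, where \<open>xs\<close> lists the entries of
  \<open>\<lambda>\<close> in \<open>\<real>\<^sup>n\<close>.
\<close>

definition tuples :: "nat \<Rightarrow> nat \<Rightarrow> nat set set" where
  "tuples n p = {T. T \<subseteq> {..<n} \<and> card T = p}"

lemma card_tuples: "card (tuples n p) = n choose p"
  unfolding tuples_def using n_subsets[of "{..<n}" p] by simp

definition tuple_sum :: "real list \<Rightarrow> nat set \<Rightarrow> real" where
  "tuple_sum xs T = (\<Sum>i\<in>T. xs ! i)"

text \<open>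
  The real eigenvalues, repeated according to algebraic multiplicity, in nondecreasing order. For a
  real symmetric \<open>n \<times> n\<close> matrix the list has length \<open>n\<close>, and algebraic and geometric multiplicities
  agree.
\<close>

definition eigenvalue_list :: "real mat \<Rightarrow> real list" where
  "eigenvalue_list A = sorted_list_of_multiset (proots (char_poly A))"

end

theory Submission
  imports Defs "Jordan_Normal_Form.Schur_Decomposition" "HOL-Combinatorics.Permutations"
begin

text \<open>
  If \<open>A = U D U\<^sup>T\<close> with \<open>U\<close> orthogonal, the diagonal of \<open>A\<close> is the image of the eigenvalue vector
  under the doubly stochastic matrix \<open>(U\<^sub>i\<^sub>j\<^sup>2)\<close> (Schur), hence lies in every convex, permutation
  invariant set that contains the eigenvalue vector. Such a set is given by the vectors \<open>\<lambda>\<close> for which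
  \<open>\<lambda>\<^bsub>[p]\<^esub>\<close> lies in \<open>\<Gamma>\<^sub>k\<close> and all quotients \<open>S\<^sub>j\<^sub>+\<^sub>1 / S\<^sub>j\<close>, \<open>j < k\<close>, at \<open>\<lambda>\<^bsub>[p]\<^esub>\<close> are at least those of
  the eigenvalues: permuting \<open>\<lambda>\<close> permutes the coordinates of \<open>\<lambda>\<^bsub>[p]\<^esub>\<close>, and the quotients are positively
  homogeneous and superadditive on \<open>\<Gamma>\<^sub>k\<close>. The product of the quotients is \<open>S\<^sub>k\<close>. Superadditivity is
  proved by induction on \<open>k\<close>, deleting one variable at a time, which maps \<open>\<Gamma>\<^sub>k\<^sub>+\<^sub>1\<close> to \<open>\<Gamma>\<^sub>k\<close> by Newton's
  inequality \<open>S\<^sub>k S\<^sub>k\<^sub>+\<^sub>2 \<le> S\<^sub>k\<^sub>+\<^sub>1\<^sup>2\<close>, valid for arbitrary reals.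
\<close>

section \<open>Elementary symmetric functions and Garding cones\<close>

lemma elem_sym_0 [simp]: "finite I \<Longrightarrow> elem_sym I 0 x = 1"
proof -
  assume "finite I"
  then have "{J. J \<subseteq> I \<and> card J = 0} = {{}}"
    by (auto dest: finite_subset)
  then show ?thesis by (simp add: elem_sym_def)
qed

lemma elem_sym_1: "elem_sym I (Suc 0) x = (\<Sum>i\<in>I. x i)"
proof -
  have "{J. J \<subseteq> I \<and> card J = Suc 0} = (\<lambda>i. {i}) ` I"
    by (auto simp: card_1_singleton_iff)
  then show ?thesis by (simp add: elem_sym_def sum.reindex)
qed

lemma elem_sym_cong: "(\<And>i. i \<in> I \<Longrightarrow> x i = y i) \<Longrightarrow> elem_sym I k x = elem_sym I k y"
  unfolding elem_sym_def by (intro sum.cong prod.cong refl) auto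

lemma elem_sym_scale: "elem_sym I k (\<lambda>i. c * x i) = c ^ k * elem_sym I k x"
  unfolding elem_sym_def sum_distrib_left
  by (intro sum.cong refl) (auto simp: prod.distrib)

lemma elem_sym_reindex:
  assumes "bij_betw f I I'"
  shows "elem_sym I k (\<lambda>i. x (f i)) = elem_sym I' k x"
proof -
  have inj: "inj_on f I" and im: "f ` I = I'"
    using assms by (auto simp: bij_betw_def)
  have "bij_betw (image f) {J. J \<subseteq> I \<and> card J = k} {J. J \<subseteq> I' \<and> card J = k}"
    using bij_betw_image_Pow[OF assms]
  proof (rule bij_betw_subset)
    show "{J. J \<subseteq> I \<and> card J = k} \<subseteq> Pow I" by auto
    show "image f ` {J. J \<subseteq> I \<and> card J = k} = {J. J \<subseteq> I' \<and> card J = k}"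
    proof (intro equalityI subsetI)
      fix J assume "J \<in> {J. J \<subseteq> I' \<and> card J = k}"
      then obtain L where "L \<subseteq> I" "J = f ` L" and "card J = k"
        using im by (auto simp: subset_image_iff)
      then show "J \<in> image f ` {J. J \<subseteq> I \<and> card J = k}"
        using inj by (auto simp: card_image inj_on_subset)
    qed (use inj im in \<open>auto simp: card_image inj_on_subset\<close>)
  qed
  then have "elem_sym I' k x = (\<Sum>J | J \<subseteq> I \<and> card J = k. \<Prod>i\<in>f ` J. x i)"
    unfolding elem_sym_def by (rule sum.reindex_bij_betw[symmetric])
  also have "\<dots> = elem_sym I k (\<lambda>i. x (f i))"
    unfolding elem_sym_def
    using inj_on_subset[OF inj] by (intro sum.cong refl) (simp add: prod.reindex)
  finally show ?thesis by simp
qed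

text \<open>Removing \<open>i\<close> is a bijection from the \<open>Suc k\<close>-element subsets
  through \<open>i\<close> onto the \<open>k\<close>-element subsets of
  \<open>I - {i}\<close>.\<close>

lemma elem_sym_containing:
  assumes "finite I" "i \<in> I"
  shows "x i * elem_sym (I - {i}) k x = (\<Sum>J | J \<subseteq> I \<and> card J = Suc k \<and> i \<in> J. \<Prod>j\<in>J. x j)"
proof -
  have "(\<Sum>J | J \<subseteq> I \<and> card J = Suc k \<and> i \<in> J. \<Prod>j\<in>J. x j)
      = (\<Sum>J | J \<subseteq> I - {i} \<and> card J = k. x i * (\<Prod>j\<in>J. x j))"
  proof (rule sum.reindex_bij_witness[where j = "\<lambda>J. J - {i}" and i = "insert i"])
    fix J assume "J \<in> {J. J \<subseteq> I \<and> card J = Suc k \<and> i \<in> J}"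
    moreover from this have "finite J" using assms finite_subset by auto
    ultimately show "x i * (\<Prod>j\<in>J - {i}. x j) = (\<Prod>j\<in>J. x j)"
      by (auto simp: prod.remove)
  next
    fix J assume "J \<in> {J. J \<subseteq> I - {i} \<and> card J = k}"
    moreover from this have "finite J" using assms finite_subset[of J I] by auto
    ultimately show "insert i J \<in> {J. J \<subseteq> I \<and> card J = Suc k \<and> i \<in> J}"
      using assms by (auto simp: card_insert_if)
  qed auto
  then show ?thesis by (simp add: elem_sym_def sum_distrib_left)
qed

lemma elem_sym_remove:
  assumes "finite I" "i \<in> I"
  shows "elem_sym I (Suc k) x = elem_sym (I - {i}) (Suc k) x + x i * elem_sym (I - {i}) k x"
proof -
  have "{J. J \<subseteq> I \<and> card J = Suc k}
      = {J. J \<subseteq> I - {i} \<and> card J = Suc k} \<union> {J. J \<subseteq> I \<and> card J = Suc k \<and> i \<in> J}"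
    by auto
  then have "elem_sym I (Suc k) x = elem_sym (I - {i}) (Suc k) x
      + (\<Sum>J | J \<subseteq> I \<and> card J = Suc k \<and> i \<in> J. \<Prod>j\<in>J. x j)"
    unfolding elem_sym_def using assms(1)
    by (simp only:, intro sum.union_disjoint) auto
  then show ?thesis by (simp add: elem_sym_containing[OF assms])
qed

text \<open>Double counting: each \<open>Suc k\<close>-element subset arises once for each of its
  elements. This is Euler's identity, as \<open>elem_sym (I - {i}) k x\<close> is a partial
  derivative.\<close>

lemma sum_elem_sym_remove:
  assumes "finite I"
  shows "(\<Sum>i\<in>I. x i * elem_sym (I - {i}) k x) = real (Suc k) * elem_sym I (Suc k) x"
proof -
  let ?F = "{J. J \<subseteq> I \<and> card J = Suc k}"
  have fin: "finite ?F" using assms by auto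
  have "(\<Sum>i\<in>I. x i * elem_sym (I - {i}) k x)
      = (\<Sum>i\<in>I. \<Sum>J | J \<in> ?F \<and> i \<in> J. \<Prod>j\<in>J. x j)"
    by (intro sum.cong refl) (simp add: elem_sym_containing[OF assms] conj_assoc)
  also have "\<dots> = (\<Sum>J\<in>?F. \<Sum>i | i \<in> I \<and> i \<in> J. \<Prod>j\<in>J. x j)"
    by (rule sum.swap_restrict[OF assms fin])
  also have "\<dots> = (\<Sum>J\<in>?F. real (Suc k) * (\<Prod>j\<in>J. x j))"
  proof (intro sum.cong refl)
    fix J assume J: "J \<in> ?F"
    then have "{i. i \<in> I \<and> i \<in> J} = J" by auto
    then show "(\<Sum>i | i \<in> I \<and> i \<in> J. \<Prod>j\<in>J. x j) = real (Suc k) * (\<Prod>j\<in>J. x j)"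
      using J by simp
  qed
  finally show ?thesis by (simp add: elem_sym_def sum_distrib_left)
qed

text \<open>
  Write \<open>E\<^sub>j\<close> and \<open>E\<^sub>j\<^sub>;\<^sub>i\<close> for the elementary symmetric functions with and without the variable \<open>x\<^sub>i\<close>.
  Induct on \<open>k\<close> by means of the identity
  \<open>(k + 1) (E\<^sub>k\<^sup>2 - E\<^sub>k\<^sub>-\<^sub>1 E\<^sub>k\<^sub>+\<^sub>1) = E\<^sub>k\<^sup>2 + (\<Sum>i. x\<^sub>i\<^sup>2 (E\<^sub>k\<^sub>-\<^sub>1\<^sub>;\<^sub>i\<^sup>2 - E\<^sub>k\<^sub>-\<^sub>2\<^sub>;\<^sub>i E\<^sub>k\<^sub>;\<^sub>i))\<close>.
\<close>
lemma elem_sym_newton: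
  assumes "finite I"
  shows "elem_sym I k x * elem_sym I (Suc (Suc k)) x \<le> (elem_sym I (Suc k) x)\<^sup>2"
  using assms
proof (induction k arbitrary: I)
  case 0
  let ?E = "\<lambda>k. elem_sym I k x"
  have "real 2 * ?E 2 = (\<Sum>i\<in>I. x i * (?E 1 - x i))"
    using sum_elem_sym_remove[OF 0, of x 1] elem_sym_remove[OF 0, of _ 0 x] 0
    by (auto simp: numeral_2_eq_2 intro!: sum.cong)
  also have "\<dots> = (?E 1)\<^sup>2 - (\<Sum>i\<in>I. (x i)\<^sup>2)"
    by (simp add: right_diff_distrib sum_subtractf sum_distrib_right[symmetric] power2_eq_square
        elem_sym_1)
  finally have "real 2 * ?E 2 = (?E 1)\<^sup>2 - (\<Sum>i\<in>I. (x i)\<^sup>2)" .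
  moreover have "(\<Sum>i\<in>I. (x i)\<^sup>2) \<ge> 0" by (simp add: sum_nonneg)
  moreover have "(?E 1)\<^sup>2 \<ge> 0" by simp
  ultimately have "?E 2 \<le> (?E 1)\<^sup>2" by linarith
  then show ?case using 0 by (simp add: numeral_2_eq_2)
next
  case (Suc k)
  let ?E = "\<lambda>k. elem_sym I k x"
  let ?D = "\<lambda>i k. elem_sym (I - {i}) k x"
  \<comment> \<open>On expanding both factors \<open>?E\<close> on the right in the variable
    \<open>x i\<close>, the mixed products of \<open>?D i (Suc k)\<close> and
    \<open>?D i (Suc (Suc k))\<close> cancel.\<close>
  have step: "(x i)\<^sup>2 * ((?D i (Suc k))\<^sup>2 - ?D i k * ?D i (Suc (Suc k)))
      = ?E (Suc (Suc k)) * (x i * ?D i (Suc k)) - ?E (Suc k) * (x i * ?D i (Suc (Suc k)))"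
    if "i \<in> I" for i
    unfolding elem_sym_remove[OF Suc.prems that, of "Suc k"] elem_sym_remove[OF Suc.prems that, of k]
    by (simp add: power2_eq_square algebra_simps)
  have "0 \<le> (\<Sum>i\<in>I. (x i)\<^sup>2 * ((?D i (Suc k))\<^sup>2 - ?D i k * ?D i (Suc (Suc k))))"
    using Suc by (intro sum_nonneg mult_nonneg_nonneg) auto
  also have "\<dots> = (\<Sum>i\<in>I. ?E (Suc (Suc k)) * (x i * ?D i (Suc k))
      - ?E (Suc k) * (x i * ?D i (Suc (Suc k))))"
    using step by (rule sum.cong[OF refl])
  also have "\<dots> = ?E (Suc (Suc k)) * (real (Suc (Suc k)) * ?E (Suc (Suc k)))
      - ?E (Suc k) * (real (Suc (Suc (Suc k))) * ?E (Suc (Suc (Suc k))))"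
    using Suc.prems
    by (simp only: sum_subtractf sum_distrib_left[symmetric] sum_elem_sym_remove)
  \<comment> \<open>Raising the coefficient of the square from \<open>k + 2\<close> to
    \<open>k + 3\<close> adds the isolated square of the identity and leaves a common
    factor.\<close>
  also have "\<dots> \<le> real (Suc (Suc (Suc k))) *
      ((?E (Suc (Suc k)))\<^sup>2 - ?E (Suc k) * ?E (Suc (Suc (Suc k))))"
    by (simp add: power2_eq_square algebra_simps)
  finally show ?case by (simp add: zero_le_mult_iff del: of_nat_Suc)
qed

section \<open>Garding cones under deletion of a variable\<close>

lemma garding_cone_Suc:
  "x \<in> garding_cone I (Suc k) \<longleftrightarrow> x \<in> garding_cone I k \<and> elem_sym I (Suc k) x > 0"
  by (auto simp: garding_cone_def le_Suc_eq)

lemma garding_cone_pos: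
  "finite I \<Longrightarrow> x \<in> garding_cone I k \<Longrightarrow> j \<le> k \<Longrightarrow> elem_sym I j x > 0"
  by (cases j) (auto simp: garding_cone_def)

text \<open>Let \<open>?D\<close> be the functions on \<open>I - {i}\<close>. If
  \<open>?D (Suc k) \<le> 0 < ?D k\<close>, positivity on \<open>I\<close> at orders
  \<open>Suc k\<close> and \<open>Suc (Suc k)\<close> forces \<open>x i > 0\<close> and then
  \<open>?D k * ?D (Suc (Suc k)) > (?D (Suc k))\<^sup>2\<close>, against Newton.\<close>

lemma garding_cone_remove:
  assumes "finite I" "i \<in> I" "x \<in> garding_cone I (Suc k)"
  shows "x \<in> garding_cone (I - {i}) k"
  using assms(3)
proof (induction k)
  case 0
  then show ?case by (simp add: garding_cone_def)
next
  case (Suc k)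
  let ?E = "\<lambda>k. elem_sym I k x"
  let ?D = "\<lambda>k. elem_sym (I - {i}) k x"
  have IH: "x \<in> garding_cone (I - {i}) k"
    using Suc by (auto simp: garding_cone_Suc)
  have D: "?D k > 0" using garding_cone_pos[OF _ IH] assms(1) by simp
  have 1: "?D (Suc k) + x i * ?D k > 0" and 2: "?D (Suc (Suc k)) + x i * ?D (Suc k) > 0"
    using Suc.prems elem_sym_remove[OF assms(1,2), of k x]
      elem_sym_remove[OF assms(1,2), of "Suc k" x] by (auto simp: garding_cone_Suc)
  have "?D (Suc k) > 0"
  proof (rule ccontr)
    assume "\<not> ?D (Suc k) > 0"
    then have s: "- ?D (Suc k) \<ge> 0" by simp
    have xD: "x i * ?D k > - ?D (Suc k)" using 1 by simp
    then have x: "x i > 0" using D s by (smt (verit) mult_nonpos_nonneg)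
    have D2: "?D (Suc (Suc k)) > x i * (- ?D (Suc k))" using 2 by simp
    have "(x i * (- ?D (Suc k))) * (- ?D (Suc k)) \<le> (x i * (- ?D (Suc k))) * (x i * ?D k)"
      using xD x s by (intro mult_left_mono mult_nonneg_nonneg) auto
    also have "\<dots> < ?D (Suc (Suc k)) * (x i * ?D k)"
      using D2 x D by (intro mult_strict_right_mono) auto
    finally have "x i * (?D (Suc k))\<^sup>2 < x i * (?D k * ?D (Suc (Suc k)))"
      by (simp add: power2_eq_square algebra_simps)
    then have "(?D (Suc k))\<^sup>2 < ?D k * ?D (Suc (Suc k))" using x by simp
    then show False using elem_sym_newton[of "I - {i}" k x] assms(1) by simp
  qed
  with IH show ?case by (simp add: garding_cone_Suc)
qed

section \<open>Superadditivity of quotients of consecutive elementary symmetric functions\<close>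

definition elem_quot :: "'i set \<Rightarrow> nat \<Rightarrow> ('i \<Rightarrow> real) \<Rightarrow> real" where
  "elem_quot I k x = elem_sym I (Suc k) x / elem_sym I k x"

lemma garding_cone_add_elem_quot_pos:
  assumes "finite I" "i \<in> I" "x \<in> garding_cone I (Suc k)"
  shows "x i + elem_quot (I - {i}) k x > 0"
proof -
  have D: "elem_sym (I - {i}) k x > 0"
    using garding_cone_pos[OF _ garding_cone_remove[OF assms]] assms(1) by simp
  have "x i + elem_quot (I - {i}) k x = elem_sym I (Suc k) x / elem_sym (I - {i}) k x"
    using D by (simp add: elem_quot_def elem_sym_remove[OF assms(1,2), of k] field_simps)
  with D assms(3) show ?thesis by (simp add: garding_cone_Suc)
qed

text \<open>Divide Euler's identity by \<open>elem_sym I (Suc k) x\<close> and replace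
  \<open>elem_sym (I - {i}) (Suc k) x\<close> by
  \<open>elem_sym I (Suc k) x - x i * elem_sym (I - {i}) k x\<close>.\<close>

lemma elem_quot_Suc:
  assumes "finite I" "x \<in> garding_cone I (Suc k)"
  shows "real (Suc (Suc k)) * elem_quot I (Suc k) x
    = (\<Sum>i\<in>I. x i - (x i)\<^sup>2 / (x i + elem_quot (I - {i}) k x))"
proof -
  have "real (Suc (Suc k)) * elem_quot I (Suc k) x
      = (\<Sum>i\<in>I. x i * elem_sym (I - {i}) (Suc k) x / elem_sym I (Suc k) x)"
    by (simp only: elem_quot_def sum_divide_distrib[symmetric] sum_elem_sym_remove[OF assms(1)]
        times_divide_eq_right)
  also have "\<dots> = (\<Sum>i\<in>I. x i - (x i)\<^sup>2 / (x i + elem_quot (I - {i}) k x))"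
  proof (rule sum.cong[OF refl])
    fix i assume i: "i \<in> I"
    let ?D = "\<lambda>k. elem_sym (I - {i}) k x"
    have D: "?D k > 0"
      using garding_cone_pos[OF _ garding_cone_remove[OF assms(1) i assms(2)]] assms(1) by simp
    have E: "elem_sym I (Suc k) x > 0" "elem_sym I (Suc k) x = ?D (Suc k) + x i * ?D k"
      using assms elem_sym_remove[OF assms(1) i, of k] by (auto simp: garding_cone_Suc)
    have "x i + elem_quot (I - {i}) k x = elem_sym I (Suc k) x / ?D k"
      using D by (simp add: E(2) elem_quot_def field_simps)
    then have "x i - (x i)\<^sup>2 / (x i + elem_quot (I - {i}) k x)
        = x i - (x i)\<^sup>2 * ?D k / elem_sym I (Suc k) x"
      by simp
    also have "\<dots> = x i * (elem_sym I (Suc k) x - x i * ?D k) / elem_sym I (Suc k) x"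
      using E(1) by (simp add: field_simps power2_eq_square)
    finally show "x i * ?D (Suc k) / elem_sym I (Suc k) x
        = x i - (x i)\<^sup>2 / (x i + elem_quot (I - {i}) k x)"
      by (simp add: E(2))
  qed
  finally show ?thesis .
qed

text \<open>A square over a positive denominator is jointly convex and homogeneous of degree one,
  hence subadditive; enlarging the denominator only helps.\<close>

lemma add_squared_div_le:
  fixes a b s t :: real
  assumes "s > 0" "t > 0" "s + t \<le> r"
  shows "(a + b)\<^sup>2 / r \<le> a\<^sup>2 / s + b\<^sup>2 / t"
proof -
  have "(a + b)\<^sup>2 / r \<le> (a + b)\<^sup>2 / (s + t)"
    using assms by (intro divide_left_mono) auto
  also have "\<dots> \<le> a\<^sup>2 / s + b\<^sup>2 / t"
  proof -
    have "a\<^sup>2 / s + b\<^sup>2 / t - (a + b)\<^sup>2 / (s + t) = (a * t - b * s)\<^sup>2 / (s * t * (s + t))"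
      using assms by (simp add: field_simps power2_eq_square)
    moreover have "\<dots> \<ge> 0" using assms by simp
    ultimately show ?thesis by linarith
  qed
  finally show ?thesis .
qed

text \<open>
  The argument of Marcus and Lopes: in \<open>elem_quot_Suc\<close> the quotients of order \<open>k\<close> occur only in
  the denominators, where superadditivity is available by induction.
\<close>
lemma garding_cone_add:
  assumes "finite I" "x \<in> garding_cone I (Suc k)" "y \<in> garding_cone I (Suc k)"
  shows "(\<lambda>i. x i + y i) \<in> garding_cone I (Suc k) \<and>
    elem_quot I k x + elem_quot I k y \<le> elem_quot I k (\<lambda>i. x i + y i)"
  using assms
proof (induction k arbitrary: I)
  case 0
  then show ?case
    by (auto simp: garding_cone_Suc elem_quot_def elem_sym_1 sum.distrib garding_cone_def)
next
  case (Suc k)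
  let ?z = "\<lambda>i. x i + y i"
  have xy: "x \<in> garding_cone I (Suc k)" "y \<in> garding_cone I (Suc k)"
    using Suc.prems by (auto simp: garding_cone_Suc)
  then have z: "?z \<in> garding_cone I (Suc k)" using Suc.IH Suc.prems(1) by blast
  have *: "(x i - (x i)\<^sup>2 / (x i + elem_quot (I - {i}) k x))
      + (y i - (y i)\<^sup>2 / (y i + elem_quot (I - {i}) k y))
      \<le> ?z i - (?z i)\<^sup>2 / (?z i + elem_quot (I - {i}) k ?z)" if i: "i \<in> I" for i
  proof -
    \<comment> \<open>Deleting \<open>i\<close> lowers the order of the cone by one, to exactly the
      order that the induction hypothesis on \<open>I - {i}\<close> asks for.\<close>
    have "elem_quot (I - {i}) k x + elem_quot (I - {i}) k y \<le> elem_quot (I - {i}) k ?z"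
      using Suc.IH[of "I - {i}"] garding_cone_remove[OF Suc.prems(1) i] Suc.prems by simp
    then have "(x i + y i)\<^sup>2 / (?z i + elem_quot (I - {i}) k ?z)
        \<le> (x i)\<^sup>2 / (x i + elem_quot (I - {i}) k x) + (y i)\<^sup>2 / (y i + elem_quot (I - {i}) k y)"
      using garding_cone_add_elem_quot_pos[OF Suc.prems(1) i] xy
      by (intro add_squared_div_le) auto
    then show ?thesis by simp
  qed
  have "real (Suc (Suc k)) * (elem_quot I (Suc k) x + elem_quot I (Suc k) y)
      \<le> real (Suc (Suc k)) * elem_quot I (Suc k) ?z"
    unfolding distrib_left elem_quot_Suc[OF Suc.prems(1) xy(1)] elem_quot_Suc[OF Suc.prems(1) xy(2)]
      elem_quot_Suc[OF Suc.prems(1) z] sum.distrib[symmetric]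
    by (rule sum_mono[OF *])
  then have quot: "elem_quot I (Suc k) x + elem_quot I (Suc k) y \<le> elem_quot I (Suc k) ?z"
    by (simp del: of_nat_Suc)
  \<comment> \<open>A positive quotient with positive denominator lifts \<open>?z\<close> to the
    cone of the next order.\<close>
  have "elem_quot I (Suc k) x > 0" "elem_quot I (Suc k) y > 0"
    using Suc.prems by (auto simp: elem_quot_def garding_cone_Suc)
  with quot have "elem_quot I (Suc k) ?z > 0" by linarith
  with z have "elem_sym I (Suc (Suc k)) ?z > 0"
    by (auto simp: elem_quot_def garding_cone_Suc zero_less_divide_iff)
  with z quot show ?case by (simp add: garding_cone_Suc)
qed

section \<open>Dominance of quotients as a convex, symmetric condition\<close>

lemma garding_cone_scale:
  "c > 0 \<Longrightarrow> x \<in> garding_cone I k \<Longrightarrow> (\<lambda>i. c * x i) \<in> garding_cone I k"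
  by (simp add: garding_cone_def elem_sym_scale)

lemma elem_quot_scale: "c \<noteq> 0 \<Longrightarrow> elem_quot I k (\<lambda>i. c * x i) = c * elem_quot I k x"
  by (simp add: elem_quot_def elem_sym_scale)

text \<open>
  Unlike \<open>elem_sym I k b \<le> elem_sym I k x\<close>, whose convexity in \<open>x\<close> is not evident, this stronger
  condition is convex directly by superadditivity of the quotients.
\<close>
definition quot_dominates :: "'i set \<Rightarrow> nat \<Rightarrow> ('i \<Rightarrow> real) \<Rightarrow> ('i \<Rightarrow> real) \<Rightarrow> bool" where
  "quot_dominates I k b x \<longleftrightarrow>
    x \<in> garding_cone I k \<and> (\<forall>j<k. elem_quot I j b \<le> elem_quot I j x)"

lemma quot_dominates_convex:
  assumes "finite I" "0 \<le> t" "t \<le> 1" "quot_dominates I k b x" "quot_dominates I k b y"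
  shows "quot_dominates I k b (\<lambda>i. t * x i + (1 - t) * y i)"
proof (cases "t = 0 \<or> t = 1 \<or> k = 0")
  \<comment> \<open>Scaling needs positive factors, and for \<open>k = 0\<close> there is no top
    order \<open>Suc (k - 1)\<close>.\<close>
  case True
  then show ?thesis using assms by (auto simp: quot_dominates_def garding_cone_def)
next
  case False
  with assms have t: "0 < t" "0 < 1 - t" by auto
  have *: "(\<lambda>i. t * x i + (1 - t) * y i) \<in> garding_cone I (Suc j) \<and>
      elem_quot I j b \<le> elem_quot I j (\<lambda>i. t * x i + (1 - t) * y i)" if j: "j < k" for j
  proof -
    have "x \<in> garding_cone I (Suc j)" "y \<in> garding_cone I (Suc j)"
      using assms j by (auto simp: quot_dominates_def garding_cone_def)
    note add = garding_cone_add[OF assms(1) garding_cone_scale[OF t(1) this(1)]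
        garding_cone_scale[OF t(2) this(2)]]
    have "elem_quot I j b = t * elem_quot I j b + (1 - t) * elem_quot I j b"
      by (simp add: algebra_simps)
    also have "\<dots> \<le> t * elem_quot I j x + (1 - t) * elem_quot I j y"
      using assms t j by (intro add_mono mult_left_mono) (auto simp: quot_dominates_def)
    also have "\<dots> \<le> elem_quot I j (\<lambda>i. t * x i + (1 - t) * y i)"
      using add t by (simp add: elem_quot_scale)
    finally show ?thesis using add by blast
  qed
  from False have "k = Suc (k - 1)" "k - 1 < k" by auto
  with *[of "k - 1"] * show ?thesis by (auto simp: quot_dominates_def)
qed

text \<open>On the cone, \<open>elem_sym I j\<close> is the telescoping product of the positive
  quotients of orders below \<open>j\<close>, starting from 1 at order 0.\<close>

lemma quot_dominates_elem_sym_le: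
  assumes "finite I" "b \<in> garding_cone I k" "quot_dominates I k b x" "j \<le> k"
  shows "elem_sym I j b \<le> elem_sym I j x"
  using assms(4)
proof (induction j)
  case 0
  then show ?case using assms by simp
next
  case (Suc j)
  have pos: "elem_sym I j b > 0" "elem_sym I j x > 0" "elem_sym I (Suc j) b > 0"
    using garding_cone_pos[OF assms(1)] Suc.prems assms by (auto simp: quot_dominates_def)
  have "elem_sym I (Suc j) b = elem_quot I j b * elem_sym I j b"
    using pos by (simp add: elem_quot_def)
  also have "\<dots> \<le> elem_quot I j x * elem_sym I j x"
  proof (rule mult_mono)
    show "elem_quot I j b \<le> elem_quot I j x"
      using assms(3) Suc.prems by (auto simp: quot_dominates_def)
    moreover have "elem_quot I j b > 0" using pos by (simp add: elem_quot_def)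
    ultimately show "elem_quot I j x \<ge> 0" by linarith
  qed (use Suc pos in auto)
  also have "\<dots> = elem_sym I (Suc j) x"
    using pos by (simp add: elem_quot_def)
  finally show ?case .
qed

lemma quot_dominates_reindex:
  assumes "bij_betw f I I"
  shows "quot_dominates I k b (\<lambda>i. x (f i)) \<longleftrightarrow> quot_dominates I k b x"
  by (simp add: quot_dominates_def garding_cone_def elem_quot_def elem_sym_reindex[OF assms])

lemma quot_dominates_cong:
  assumes "\<And>i. i \<in> I \<Longrightarrow> x i = y i"
  shows "quot_dominates I k b x \<longleftrightarrow> quot_dominates I k b y"
  using elem_sym_cong[of I x y, OF assms]
  by (simp add: quot_dominates_def garding_cone_def elem_quot_def)

section \<open>Majorization\<close>

text \<open>
  Hardy--Littlewood--Polya: move mass \<open>\<delta>\<close> between two coordinates of \<open>y\<close>, chosen with no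
  disagreement between \<open>x\<close> and \<open>y\<close> in between, until one more coordinate agrees with \<open>x\<close>. As the
  predicate \<open>K\<close> is permutation invariant, only \<open>x\<close> needs to be sorted.
\<close>
lemma majorization_induct:
  fixes x y :: "nat \<Rightarrow> real"
  assumes perm: "\<And>y \<pi>. K y \<Longrightarrow> \<pi> permutes {..<n} \<Longrightarrow> K (\<lambda>i. y (\<pi> i))"
    and convex: "\<And>y z t. K y \<Longrightarrow> K z \<Longrightarrow> 0 \<le> t \<Longrightarrow> t \<le> 1 \<Longrightarrow> K (\<lambda>i. t * y i + (1 - t) * z i)"
    and cong: "\<And>y z. K y \<Longrightarrow> (\<And>i. i < n \<Longrightarrow> y i = z i) \<Longrightarrow> K z"
    and mono: "\<And>i j. i \<le> j \<Longrightarrow> j < n \<Longrightarrow> x i \<le> x j"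
    and prefix: "\<And>m. m \<le> n \<Longrightarrow> (\<Sum>i<m. y i) \<le> (\<Sum>i<m. x i)"
    and total: "(\<Sum>i<n. y i) = (\<Sum>i<n. x i)"
    and "K y"
  shows "K x"
  using prefix total \<open>K y\<close>
proof (induction "card {i. i < n \<and> x i \<noteq> y i}" arbitrary: y rule: less_induct)
  case less
  show ?case
  proof (cases "\<exists>k<n. x k < y k")
    case False
    then have le: "y i \<le> x i" if "i < n" for i using that by force
    have "(\<Sum>i<n. x i - y i) = 0" using less.prems(2) by (simp add: sum_subtractf)
    then have "x i - y i = 0" if "i < n" for i
      using le that by (subst (asm) sum_nonneg_eq_0_iff) auto
    then show ?thesis using cong[OF less.prems(3), of x] by force
  next
    case True
    define k where "k = (LEAST k. k < n \<and> x k < y k)"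
    from True have k: "k < n" "x k < y k" unfolding k_def by (metis (mono_tags, lifting) LeastI)+
    have below_k: "y i \<le> x i" if "i < k" for i
      using not_less_Least[of i "\<lambda>k. k < n \<and> x k < y k"] that k unfolding k_def by force
    have "\<exists>j<k. y j < x j"
    proof (rule ccontr)
      assume "\<not> (\<exists>j<k. y j < x j)"
      then have "(\<Sum>i<k. x i) \<le> (\<Sum>i<k. y i)" by (intro sum_mono) auto
      then have "(\<Sum>i<Suc k. x i) < (\<Sum>i<Suc k. y i)" using k by simp
      with less.prems(1)[of "Suc k"] k show False by simp
    qed
    define j where "j = Max {j. j < k \<and> y j < x j}"
    have "j \<in> {j. j < k \<and> y j < x j}"
      unfolding j_def using \<open>\<exists>j<k. y j < x j\<close> by (intro Max_in) auto
    then have j: "j < k" "y j < x j" by auto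
    have between: "x i = y i" if "j < i" "i < k" for i
    proof -
      have "i \<notin> {j. j < k \<and> y j < x j}"
        using that Max_ge[of "{j. j < k \<and> y j < x j}" i] unfolding j_def by fastforce
      with below_k[of i] that show ?thesis by auto
    qed
    define \<delta> where "\<delta> = min (x j - y j) (y k - x k)"
    have \<delta>: "\<delta> > 0" "y j + \<delta> \<le> x j" "x k \<le> y k - \<delta>" using j k by (auto simp: \<delta>_def)
    have xjk: "x j \<le> x k" using mono[of j k] j k by simp
    define z where "z = (\<lambda>i. y i + (if i = j then \<delta> else 0) - (if i = k then \<delta> else 0))"
    have sum_z: "(\<Sum>i<m. z i) = (\<Sum>i<m. y i) + (if j < m then \<delta> else 0) - (if k < m then \<delta> else 0)"
      for m by (simp add: z_def sum.distrib sum_subtractf)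
    have z_prefix: "(\<Sum>i<m. z i) \<le> (\<Sum>i<m. x i)" if m: "m \<le> n" for m
    proof (cases "j < m \<and> m \<le> k")
      \<comment> \<open>Only these prefix sums grow, by \<open>\<delta>\<close>. All terms
        \<open>x i - y i\<close> below \<open>k\<close> are nonnegative, so the one at
        \<open>j\<close> pays for the growth.\<close>
      case True
      have "\<delta> \<le> x j - y j" using \<delta> by simp
      also have "\<dots> = (\<Sum>i\<in>{j}. x i - y i)" by simp
      also have "\<dots> \<le> (\<Sum>i<m. x i - y i)"
        using True below_k by (intro sum_mono2) auto
      finally show ?thesis using True by (simp add: sum_z sum_subtractf)
    next
      case False
      with less.prems(1)[OF m] j show ?thesis by (auto simp: sum_z)
    qed
    have "K z"
    proof -
      \<comment> \<open>Solved from \<open>(1 - t) * (y k - y j) = \<delta>\<close>, so that mixing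
        \<open>y\<close> with its transposition gives \<open>z\<close>. Sortedness of
        \<open>x\<close> yields \<open>\<delta> \<le> y k - y j\<close>, hence
        \<open>0 \<le> t\<close>.\<close>
      define t where "t = 1 - \<delta> / (y k - y j)"
      have d: "y k - y j > 0" "\<delta> \<le> y k - y j" using xjk \<delta> by linarith+
      then have t: "0 \<le> t" "t \<le> 1" "(1 - t) * (y k - y j) = \<delta>"
        using \<delta> by (auto simp: t_def)
      let ?\<tau> = "transpose j k"
      have "K (\<lambda>i. y (?\<tau> i))"
        using perm[OF less.prems(3)] permutes_swap_id[of j "{..<n}" k] j k by simp
      from convex[OF less.prems(3) this t(1,2)] show "K z"
      proof (rule cong)
        fix i
        show "t * y i + (1 - t) * y (?\<tau> i) = z i"
          using t(3) j by (auto simp: z_def transpose_def algebra_simps)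
      qed
    qed
    have "{i. i < n \<and> x i \<noteq> z i} \<subset> {i. i < n \<and> x i \<noteq> y i}"
    proof
      have "x i \<noteq> y i" if "x i \<noteq> z i" for i
        using that j k by (auto simp: z_def split: if_splits)
      then show "{i. i < n \<and> x i \<noteq> z i} \<subseteq> {i. i < n \<and> x i \<noteq> y i}" by auto
      \<comment> \<open>As \<open>\<delta>\<close> is a minimum, one of the two moved coordinates
        reaches \<open>x\<close>, which lowers the induction measure.\<close>
      have "z j = x j \<or> z k = x k" using j by (auto simp: z_def \<delta>_def min_def)
      then obtain l where "l \<in> {j, k}" "z l = x l" by blast
      then have "l \<in> {i. i < n \<and> x i \<noteq> y i}" "l \<notin> {i. i < n \<and> x i \<noteq> z i}"
        using j k by auto
      then show "{i. i < n \<and> x i \<noteq> z i} \<noteq> {i. i < n \<and> x i \<noteq> y i}" by metis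
    qed
    then have "card {i. i < n \<and> x i \<noteq> z i} < card {i. i < n \<and> x i \<noteq> y i}"
      by (intro psubset_card_mono) auto
    moreover have "(\<Sum>i<n. z i) = (\<Sum>i<n. x i)"
      using less.prems(2) j k by (simp add: sum_z)
    ultimately show ?thesis by (intro less.hyps[of z] z_prefix \<open>K z\<close>)
  qed
qed

section \<open>Sorting and doubly stochastic averages\<close>

lemma sorting_permutation:
  fixes x :: "nat \<Rightarrow> 'a :: linorder"
  obtains \<pi> where "\<pi> permutes {..<n}" "\<And>i j. i \<le> j \<Longrightarrow> j < n \<Longrightarrow> x (\<pi> i) \<le> x (\<pi> j)"
proof -
  let ?xs = "map x [0..<n]"
  have "mset (sort ?xs) = mset ?xs" by simp
  then obtain \<pi> where \<pi>: "\<pi> permutes {..<length ?xs}" "permute_list \<pi> ?xs = sort ?xs"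
    by (rule mset_eq_permutation)
  have "x (\<pi> i) \<le> x (\<pi> j)" if "i \<le> j" "j < n" for i j
  proof -
    have nth: "sort ?xs ! l = x (\<pi> l)" if "l < n" for l
      using that \<pi> permutes_in_image[OF \<pi>(1), of l]
      by (simp flip: \<pi>(2) add: permute_list_nth)
    have "sort ?xs ! i \<le> sort ?xs ! j"
      using that by (intro sorted_nth_mono) auto
    then show ?thesis using that nth by simp
  qed
  with \<pi>(1) that show ?thesis by simp
qed

text \<open>The right side weighs \<open>y\<close> by partial column sums in [0,1] of total
  \<open>m\<close>; for nondecreasing \<open>y\<close> this is least with all weight on the first
  \<open>m\<close> coordinates.\<close>

lemma doubly_stochastic_prefix:
  fixes P :: "nat \<Rightarrow> nat \<Rightarrow> real" and y :: "nat \<Rightarrow> real"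
  assumes nonneg: "\<And>i j. i < n \<Longrightarrow> j < n \<Longrightarrow> P i j \<ge> 0"
    and row: "\<And>i. i < n \<Longrightarrow> (\<Sum>j<n. P i j) = 1"
    and col: "\<And>j. j < n \<Longrightarrow> (\<Sum>i<n. P i j) = 1"
    and mono: "\<And>i j. i \<le> j \<Longrightarrow> j < n \<Longrightarrow> y i \<le> y j"
    and m: "m \<le> n"
  shows "(\<Sum>j<m. y j) \<le> (\<Sum>i<m. \<Sum>j<n. P i j * y j)"
proof (cases "m = n")
  case True
  have "(\<Sum>i<n. \<Sum>j<n. P i j * y j) = (\<Sum>j<n. (\<Sum>i<n. P i j) * y j)"
    by (subst sum.swap) (simp add: sum_distrib_right)
  then show ?thesis using col True by simp
next
  case False
  define c where "c = (\<lambda>j. \<Sum>i<m. P i j)"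
  have c: "0 \<le> c j" "c j \<le> 1" if "j < n" for j
    using that m sum_mono2[of "{..<n}" "{..<m}" "\<lambda>i. P i j"] col[OF that] nonneg
    by (auto simp: c_def intro!: sum_nonneg)
  have total: "(\<Sum>j<n. c j) = real m"
    unfolding c_def using m row by (subst sum.swap) simp
  let ?\<chi> = "\<lambda>j. if j < m then 1 else 0 :: real"
  have \<chi>: "(\<Sum>j<n. ?\<chi> j * f j) = (\<Sum>j<m. f j)" for f :: "nat \<Rightarrow> real"
    using m by (intro sum.mono_neutral_cong_right) auto
  \<comment> \<open>The threshold \<open>y m\<close> lies in range because \<open>m < n\<close>
    here. Both factors are nonpositive for \<open>j < m\<close> and nonnegative from
    \<open>m\<close> on; the threshold cancels afterwards because \<open>c\<close> and
    \<open>?\<chi>\<close> have the same total.\<close>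
  have "0 \<le> (\<Sum>j<n. (c j - ?\<chi> j) * (y j - y m))"
  proof (rule sum_nonneg)
    fix j assume "j \<in> {..<n}"
    then show "0 \<le> (c j - ?\<chi> j) * (y j - y m)"
      using c[of j] mono[of j m] mono[of m j] False m
      by (cases "j < m") (auto intro: mult_nonpos_nonpos)
  qed
  also have "\<dots> = (\<Sum>j<n. c j * y j) - (\<Sum>j<m. y j) - y m * ((\<Sum>j<n. c j) - (\<Sum>j<n. ?\<chi> j * 1))"
    unfolding \<chi>[of y, symmetric]
    by (simp add: algebra_simps sum_subtractf sum.distrib sum_distrib_left)
  also have "\<dots> = (\<Sum>j<n. c j * y j) - (\<Sum>j<m. y j)"
    unfolding \<chi> total by simp
  also have "(\<Sum>j<n. c j * y j) = (\<Sum>i<m. \<Sum>j<n. P i j * y j)"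
    unfolding c_def sum_distrib_right by (rule sum.swap)
  finally show ?thesis by simp
qed

text \<open>Sorting the average by \<open>\<pi>\<close> permutes the rows of \<open>P\<close>, which
  stays doubly stochastic; after \<open>majorization_induct\<close> the inverse permutation undoes
  the sorting.\<close>

lemma doubly_stochastic_induct:
  fixes P :: "nat \<Rightarrow> nat \<Rightarrow> real" and y :: "nat \<Rightarrow> real"
  assumes perm: "\<And>y \<pi>. K y \<Longrightarrow> \<pi> permutes {..<n} \<Longrightarrow> K (\<lambda>i. y (\<pi> i))"
    and convex: "\<And>y z t. K y \<Longrightarrow> K z \<Longrightarrow> 0 \<le> t \<Longrightarrow> t \<le> 1 \<Longrightarrow> K (\<lambda>i. t * y i + (1 - t) * z i)"
    and cong: "\<And>y z. K y \<Longrightarrow> (\<And>i. i < n \<Longrightarrow> y i = z i) \<Longrightarrow> K z"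
    and nonneg: "\<And>i j. i < n \<Longrightarrow> j < n \<Longrightarrow> P i j \<ge> 0"
    and row: "\<And>i. i < n \<Longrightarrow> (\<Sum>j<n. P i j) = 1"
    and col: "\<And>j. j < n \<Longrightarrow> (\<Sum>i<n. P i j) = 1"
    and mono: "\<And>i j. i \<le> j \<Longrightarrow> j < n \<Longrightarrow> y i \<le> y j"
    and "K y"
  shows "K (\<lambda>i. \<Sum>j<n. P i j * y j)"
proof -
  let ?x = "\<lambda>i. \<Sum>j<n. P i j * y j"
  obtain \<pi> where \<pi>: "\<pi> permutes {..<n}" "\<And>i j. i \<le> j \<Longrightarrow> j < n \<Longrightarrow> ?x (\<pi> i) \<le> ?x (\<pi> j)"
    using sorting_permutation[of n ?x] by blast
  have \<pi>_less: "\<pi> i < n" if "i < n" for i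
    using permutes_in_image[OF \<pi>(1), of i] that by simp
  have reindex: "(\<Sum>i<n. f (\<pi> i)) = (\<Sum>i<n. f i)" for f :: "nat \<Rightarrow> real"
    using sum.permute[OF \<pi>(1), of f] by (simp add: o_def)
  have "K (\<lambda>i. ?x (\<pi> i))"
  proof (rule majorization_induct[where n = n and y = y and K = K])
    show "(\<Sum>i<m. y i) \<le> (\<Sum>i<m. ?x (\<pi> i))" if "m \<le> n" for m
    proof (rule doubly_stochastic_prefix[where P = "\<lambda>i. P (\<pi> i)"])
      show "(\<Sum>i<n. P (\<pi> i) j) = 1" if "j < n" for j
        using reindex[of "\<lambda>i. P i j"] col that by simp
    qed (use nonneg row mono that \<pi>_less in auto)
    have "(\<Sum>i<n. ?x i) = (\<Sum>j<n. (\<Sum>i<n. P i j) * y j)"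
      by (subst sum.swap) (simp add: sum_distrib_right)
    then show "(\<Sum>i<n. y i) = (\<Sum>i<n. ?x (\<pi> i))"
      using col reindex[of ?x] by simp
  qed (fact perm convex cong \<pi>(2) \<open>K y\<close>)+
  from perm[OF this permutes_inv[OF \<pi>(1)]] show ?thesis
    by (simp add: permutes_inverses[OF \<pi>(1)])
qed

section \<open>Diagonalization of real symmetric matrices\<close>

text \<open>The Hermitian form \<open>s\<close> at an eigenvector is its own conjugate by symmetry,
  and equals \<open>z\<close> times the positive real \<open>N\<close>.\<close>

lemma symmetric_mat_eigenvalue_real:
  fixes A :: "real mat"
  assumes A: "A \<in> carrier_mat n n" and sym: "transpose_mat A = A"
    and ev: "eigenvalue (map_mat complex_of_real A) z"
  shows "Im z = 0"
proof -
  let ?B = "map_mat complex_of_real A"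
  obtain v where v: "v \<in> carrier_vec n" "v \<noteq> 0\<^sub>v n" "?B *\<^sub>v v = z \<cdot>\<^sub>v v"
    using ev A unfolding eigenvalue_def eigenvector_def by auto
  have Bv: "(\<Sum>j<n. of_real (A $$ (i,j)) * v $ j) = z * v $ i" if "i < n" for i
  proof -
    have "(?B *\<^sub>v v) $ i = (\<Sum>j<n. of_real (A $$ (i,j)) * v $ j)"
      using that A v(1) by (auto simp: scalar_prod_def lessThan_atLeast0 intro!: sum.cong)
    then show ?thesis using that v by simp
  qed
  have A_swap: "A $$ (i,j) = A $$ (j,i)" if "i < n" "j < n" for i j
    using that A arg_cong[OF sym, of "\<lambda>M. M $$ (j,i)"] by simp
  define s where "s = (\<Sum>i<n. \<Sum>j<n. cnj (v $ i) * (of_real (A $$ (i,j)) * v $ j))"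
  define N where "N = (\<Sum>i<n. (cmod (v $ i))\<^sup>2)"
  have s: "s = z * of_real N"
  proof -
    have "s = (\<Sum>i<n. cnj (v $ i) * (z * v $ i))"
      unfolding s_def using Bv by (simp flip: sum_distrib_left)
    also have "\<dots> = (\<Sum>i<n. z * of_real ((cmod (v $ i))\<^sup>2))"
      by (intro sum.cong refl) (simp only: complex_norm_square mult.commute mult.left_commute)
    finally show ?thesis by (simp add: N_def sum_distrib_left)
  qed
  have "cnj s = (\<Sum>i<n. \<Sum>j<n. cnj (v $ j) * (of_real (A $$ (j,i)) * v $ i))"
    unfolding s_def by (simp add: A_swap mult.commute mult.left_commute)
  also have "\<dots> = s" unfolding s_def by (rule sum.swap)
  finally have "Im s = 0" by (metis Reals_cnj_iff complex_is_Real_iff)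
  obtain i where "i < n" "v $ i \<noteq> 0"
    using v(1,2) by (metis eq_vecI carrier_vecD index_zero_vec)
  then have "N > 0"
    unfolding N_def by (intro sum_pos2[of _ i]) auto
  with \<open>Im s = 0\<close> s show ?thesis by simp
qed

lemma prod_list_real_linear_factors:
  assumes "\<And>z. z \<in> set zs \<Longrightarrow> Im z = 0"
  shows "map_poly complex_of_real (\<Prod>e\<leftarrow>map Re zs. [:-e, 1:]) = (\<Prod>z\<leftarrow>zs. [:-z, 1:])"
  using assms
proof (induction zs)
  case (Cons z zs)
  interpret hom: map_poly_comm_ring_hom complex_of_real ..
  have "complex_of_real (Re z) = z" using Cons.prems[of z] by (simp add: complex_eq_iff)
  then show ?case using Cons by (simp add: hom.hom_mult del: mult_pCons_left)
qed simp

text \<open>Over the complex numbers the polynomial splits with real roots, and embedding real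
  coefficients is injective.\<close>

lemma symmetric_mat_char_poly_splits:
  fixes A :: "real mat"
  assumes A: "A \<in> carrier_mat n n" and sym: "transpose_mat A = A"
  obtains es where "char_poly A = (\<Prod>e\<leftarrow>es. [:-e, 1:])"
proof -
  let ?B = "map_mat complex_of_real A"
  have B: "?B \<in> carrier_mat n n" using A by simp
  obtain zs where zs: "char_poly ?B = (\<Prod>z\<leftarrow>zs. [:-z, 1:])"
    using char_poly_factorized[OF B] by blast
  have "Im z = 0" if "z \<in> set zs" for z
  proof (rule symmetric_mat_eigenvalue_real[OF A sym])
    show "eigenvalue ?B z"
      unfolding eigenvalue_root_char_poly[OF B] zs
      using that by (force simp: poly_prod_list prod_list_zero_iff)
  qed
  then have "map_poly complex_of_real (char_poly A)
      = map_poly complex_of_real (\<Prod>e\<leftarrow>map Re zs. [:-e, 1:])"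
    using prod_list_real_linear_factors[of zs] zs by (simp flip: of_real_hom.char_poly_hom[OF A])
  then have "char_poly A = (\<Prod>e\<leftarrow>map Re zs. [:-e, 1:])"
    by (simp add: poly_eq_iff coeff_map_poly)
  then show ?thesis by (rule that)
qed

text \<open>Complete \<open>v\<close> to a basis, apply Gram-Schmidt, which keeps the first vector,
  and normalize.\<close>

lemma orthonormal_completion:
  fixes v :: "real vec"
  assumes v: "v \<in> carrier_vec n" "v \<noteq> 0\<^sub>v n"
  obtains W c where "W \<in> carrier_mat n n" "transpose_mat W * W = 1\<^sub>m n" "col W 0 = c \<cdot>\<^sub>v v"
proof -
  interpret cof_vec_space n "TYPE(real)" .
  have n: "n > 0" using v by (cases n) auto
  define b where "b = basis_completion v"
  define ws where "ws = gram_schmidt n b"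
  note b = basis_completion[OF v, folded b_def]
  obtain vs where bv: "b = v # vs" using b(6,7) n by (cases b) auto
  note gs = gram_schmidt_result[OF b(2,4,5) ws_def]
  have len: "length ws = n" using gs b(6) by simp
  have hd: "ws ! 0 = v" using gram_schmidt_hd[OF v(1), of vs, folded bv ws_def] len n
    by (simp add: hd_conv_nth flip: length_greater_0_conv)
  have ws_i: "ws ! i \<in> carrier_vec n" if "i < n" for i
    using gs(3) that len by auto
  \<comment> \<open>The case \<open>i = j\<close> says that no square vanishes, so the vectors can
    be normalized.\<close>
  have orth: "ws ! i \<bullet> ws ! j = 0 \<longleftrightarrow> i \<noteq> j" if "i < n" "j < n" for i j
    using corthogonalD[of ws i j] gs that len by simp
  define c where "c = (\<lambda>i. 1 / sqrt (ws ! i \<bullet> ws ! i))"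
  define W where "W = mat_of_cols n (map (\<lambda>i. c i \<cdot>\<^sub>v ws ! i) [0..<n])"
  have W: "W \<in> carrier_mat n n" by (rule carrier_matI) (simp_all add: W_def)
  have col: "col W i = c i \<cdot>\<^sub>v ws ! i" if "i < n" for i
    using that ws_i by (simp add: W_def)
  have "transpose_mat W * W = 1\<^sub>m n"
  proof (rule eq_matI)
    fix i j assume "i < dim_row (1\<^sub>m n :: real mat)" "j < dim_col (1\<^sub>m n :: real mat)"
    then have ij: "i < n" "j < n" by auto
    have "(transpose_mat W * W) $$ (i,j) = c i * (c j * (ws ! i \<bullet> ws ! j))"
      using ij W col ws_i[of i] ws_i[of j] by simp
    also have "\<dots> = (if i = j then 1 else 0)"
    proof (cases "i = j")
      case True
      have "ws ! i \<bullet> ws ! i > 0"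
        using orth[OF ij(1) ij(1)] conjugate_square_greater_0_vec[OF ws_i[OF ij(1)]]
          conjugate_square_eq_0_vec[OF ws_i[OF ij(1)]] by simp
      then show ?thesis using True by (simp add: c_def)
    qed (use orth[OF ij] in simp)
    finally show "(transpose_mat W * W) $$ (i,j) = 1\<^sub>m n $$ (i,j)" using ij by simp
  qed (use W in auto)
  with W col[OF n] hd that show ?thesis by auto
qed

lemma transpose_conjugation:
  fixes A U V :: "'a :: comm_ring_1 mat"
  assumes "A \<in> carrier_mat n n" "U \<in> carrier_mat n n" "V \<in> carrier_mat n n"
  shows "transpose_mat (U * V) * A * (U * V)
    = transpose_mat V * (transpose_mat U * A * U) * V"
proof -
  have c: "transpose_mat U \<in> carrier_mat n n" "transpose_mat V \<in> carrier_mat n n"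
    using assms by auto
  have "transpose_mat (U * V) * A * (U * V) = transpose_mat V * transpose_mat U * A * (U * V)"
    using assms by (simp add: transpose_mult)
  also have "\<dots> = transpose_mat V * transpose_mat U * A * U * V"
    using assms c by (intro assoc_mult_mat[symmetric]) auto
  also have "\<dots> = transpose_mat V * (transpose_mat U * A * U) * V"
    using assms c by (simp add: assoc_mult_mat[of _ n n _ n _ n])
  finally show ?thesis .
qed

text \<open>Deflation: an orthonormal basis starting with an eigenvector for \<open>e\<close> splits
  off a 1 by 1 block, in the row as well by symmetry, and leaves a block with roots
  \<open>es\<close>. With \<open>es\<close> given, its order is kept, so the sorted eigenvalue list
  can be used.\<close>

lemma symmetric_mat_diagonalization:
  fixes A :: "real mat"
  assumes "A \<in> carrier_mat n n" "transpose_mat A = A"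
    and "char_poly A = (\<Prod>e\<leftarrow>es. [:-e, 1:])"
  shows "\<exists>U \<in> carrier_mat n n. transpose_mat U * U = 1\<^sub>m n \<and>
    transpose_mat U * A * U = mat n n (\<lambda>(i,j). if i = j then es ! i else 0)"
  using assms
proof (induction es arbitrary: n A)
  case Nil
  with degree_monic_char_poly[of A n] have "n = 0" by simp
  then show ?case by (intro bexI[of _ "1\<^sub>m n"]) (auto intro!: eq_matI)
next
  case (Cons e es)
  let ?D = "\<lambda>n es. mat n n (\<lambda>(i,j). if i = j then es ! i else 0 :: real)"
  have A: "A \<in> carrier_mat n n" by fact
  have monic: "monic (\<Prod>e\<leftarrow>es. [:-e, 1:])" by (rule monic_prod_list) auto
  then have "(\<Prod>e\<leftarrow>es. [:-e, 1:]) \<noteq> 0" by auto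
  then have "degree (char_poly A) \<noteq> 0"
    unfolding Cons.prems by (simp add: degree_mult_eq del: mult_pCons_left)
  with degree_monic_char_poly[OF A] obtain m where n: "n = Suc m" by (cases n) auto
  have "eigenvalue A e"
    unfolding eigenvalue_root_char_poly[OF A] Cons.prems by simp
  then obtain v where v: "v \<in> carrier_vec n" "v \<noteq> 0\<^sub>v n" "A *\<^sub>v v = e \<cdot>\<^sub>v v"
    using A unfolding eigenvalue_def eigenvector_def by auto
  obtain W c where W: "W \<in> carrier_mat n n" "transpose_mat W * W = 1\<^sub>m n"
    and W0: "col W 0 = c \<cdot>\<^sub>v v"
    using orthonormal_completion[OF v(1,2)] by blast
  have WT: "transpose_mat W \<in> carrier_mat n n" using W by simp
  have AW0: "A *\<^sub>v col W 0 = e \<cdot>\<^sub>v col W 0"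
    using v A by (simp add: W0 mult_mat_vec smult_smult_assoc mult.commute)
  define A' where "A' = transpose_mat W * A * W"
  have A': "A' \<in> carrier_mat n n" using A W by (simp add: A'_def)
  have A'_sym: "transpose_mat A' = A'"
    using A W WT Cons.prems(2)
    by (simp add: A'_def transpose_mult[of _ n n _ n] assoc_mult_mat[of _ n n _ n _ n])
  have A'_col: "A' $$ (i,0) = (if i = 0 then e else 0)" if i: "i < n" for i
  proof -
    have "A' = transpose_mat W * (A * W)"
      using A W WT by (simp add: A'_def assoc_mult_mat[of _ n n _ n _ n])
    then have "A' $$ (i,0) = row (transpose_mat W) i \<bullet> col (A * W) 0"
      using A W i n by (simp only: index_mult_mat) simp
    also have "\<dots> = col W i \<bullet> (A *\<^sub>v col W 0)"
      using W(1) i n by (simp only: col_mult2[OF A W(1)]) simp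
    also have "\<dots> = e * (col W i \<bullet> col W 0)"
      unfolding AW0 using W i n by simp
    also have "col W i \<bullet> col W 0 = (transpose_mat W * W) $$ (i,0)"
      using W(1) i n by simp
    also have "e * \<dots> = (if i = 0 then e else 0)" unfolding W(2) using i n by simp
    finally show ?thesis .
  qed
  have A'_row: "A' $$ (0,i) = (if i = 0 then e else 0)" if "i < n" for i
    using arg_cong[OF A'_sym, of "\<lambda>M. M $$ (i,0)"] A'_col[OF that] that A' n by simp
  define A3 where "A3 = mat m m (\<lambda>(i,j). A' $$ (Suc i, Suc j))"
  have A3: "A3 \<in> carrier_mat m m" by (simp add: A3_def)
  let ?e = "mat 1 1 (\<lambda>_. e)"
  have block: "A' = four_block_mat ?e (0\<^sub>m 1 m) (0\<^sub>m m 1) A3"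
    using A' A'_col A'_row n by (intro eq_matI) (auto simp: A3_def)
  have "A3 $$ (i,j) = A3 $$ (j,i)" if "i < m" "j < m" for i j
    using arg_cong[OF A'_sym, of "\<lambda>M. M $$ (Suc j,Suc i)"] that A' n by (simp add: A3_def)
  then have A3_sym: "transpose_mat A3 = A3"
    using A3 by (intro eq_matI) auto
  have "W * transpose_mat W = 1\<^sub>m n"
    using mat_mult_left_right_inverse[OF WT W(1) W(2)] .
  then have "similar_mat A' A"
    unfolding similar_mat_def using A A' W WT
    by (intro exI[of _ "transpose_mat W"] exI[of _ W] similar_mat_witI[of _ _ n]) (auto simp: A'_def)
  then have "[:-e, 1:] * (\<Prod>e\<leftarrow>es. [:-e, 1:]) = char_poly A'"
    using char_poly_similar Cons.prems(3) by force
  also have "\<dots> = char_poly ?e * char_poly A3"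
    unfolding block by (rule char_poly_four_block_zeros_col) (use A3 in auto)
  also have "char_poly ?e = [:-e, 1:]"
    by (simp add: char_poly_defs det_def sign_def)
  finally have "char_poly A3 = (\<Prod>e\<leftarrow>es. [:-e, 1:])"
    by (metis mult_cancel_left pCons_eq_0_iff zero_neq_one)
  from Cons.IH[OF A3 A3_sym this] obtain P where P: "P \<in> carrier_mat m m"
    "transpose_mat P * P = 1\<^sub>m m" "transpose_mat P * A3 * P = ?D m es" by blast
  define Q where "Q = four_block_mat (1\<^sub>m 1) (0\<^sub>m 1 m) (0\<^sub>m m 1) P"
  have Q: "Q \<in> carrier_mat n n" using P by (intro carrier_matI) (auto simp: Q_def n)
  have QT: "transpose_mat Q = four_block_mat (1\<^sub>m 1) (0\<^sub>m 1 m) (0\<^sub>m m 1) (transpose_mat P)"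
    unfolding Q_def using P
    by (subst transpose_four_block_mat[of _ 1 1 _ m _ m]) auto
  have "transpose_mat Q * Q = four_block_mat (1\<^sub>m 1) (0\<^sub>m 1 m) (0\<^sub>m m 1) (1\<^sub>m m)"
    unfolding QT unfolding Q_def using P
    by (subst mult_four_block_mat[of _ 1 1 _ m _ m _ _ 1 _ m]) auto
  also have "\<dots> = 1\<^sub>m n" by (rule eq_matI) (auto simp: n)
  finally have QQ: "transpose_mat Q * Q = 1\<^sub>m n" .
  have "transpose_mat Q * A' = four_block_mat ?e (0\<^sub>m 1 m) (0\<^sub>m m 1) (transpose_mat P * A3)"
    unfolding QT block using P A3
    by (subst mult_four_block_mat[of _ 1 1 _ m _ m _ _ 1 _ m]) auto
  then have "transpose_mat Q * A' * Q
      = four_block_mat ?e (0\<^sub>m 1 m) (0\<^sub>m m 1) (transpose_mat P * A3 * P)"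
    unfolding Q_def using P A3
    by (simp, subst mult_four_block_mat[of _ 1 1 _ m _ m _ _ 1 _ m]) auto
  also have "\<dots> = ?D n (e # es)"
    unfolding P by (rule eq_matI) (auto simp: n nth_Cons')
  finally have QA'Q: "transpose_mat Q * A' * Q = ?D n (e # es)" .
  have "transpose_mat (W * Q) * A * (W * Q) = ?D n (e # es)"
    using transpose_conjugation[OF A W(1) Q] QA'Q by (simp add: A'_def)
  moreover have "transpose_mat (W * Q) * (W * Q) = 1\<^sub>m n"
  proof -
    have "transpose_mat (W * Q) * (W * Q) = transpose_mat Q * (transpose_mat W * 1\<^sub>m n * W) * Q"
      using transpose_conjugation[of "1\<^sub>m n" n W Q] W Q by (simp add: transpose_mult[of W n n Q n])
    then show ?thesis using W WT Q QQ by simp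
  qed
  ultimately show ?case using W(1) Q by (intro bexI[of _ "W * Q"]) auto
qed

section \<open>The diagonal as a doubly stochastic image of the spectrum\<close>

lemma diag_orthogonal_conjugation:
  fixes A U :: "real mat"
  assumes A: "A \<in> carrier_mat n n" and U: "U \<in> carrier_mat n n" "transpose_mat U * U = 1\<^sub>m n"
    and D: "transpose_mat U * A * U = mat n n (\<lambda>(i,j). if i = j then es ! i else 0)"
    and i: "i < n"
  shows "A $$ (i,i) = (\<Sum>j<n. (U $$ (i,j))\<^sup>2 * es ! j)"
proof -
  let ?D = "mat n n (\<lambda>(i,j). if i = j then es ! i else 0 :: real)"
  have UT: "transpose_mat U \<in> carrier_mat n n" using U by simp
  have UUT: "U * transpose_mat U = 1\<^sub>m n"
    using mat_mult_left_right_inverse[OF UT U] .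
  have "U * ?D * transpose_mat U = (U * transpose_mat U) * A * (U * transpose_mat U)"
    unfolding D[symmetric] using A U UT by (simp add: assoc_mult_mat[of _ n n _ n _ n])
  then have "A = U * ?D * transpose_mat U" using A by (simp add: UUT)
  moreover have "(U * ?D) $$ (i,j) = U $$ (i,j) * es ! j" if "j < n" for j
    using i that U by (simp add: scalar_prod_def if_distrib[of "\<lambda>x. _ * x"] cong: if_cong)
  ultimately have "A $$ (i,i) = (\<Sum>j<n. U $$ (i,j) * es ! j * U $$ (i,j))"
    using i U(1) UT
    by (subst (asm) mat_eq_iff) (simp add: scalar_prod_def lessThan_atLeast0)
  then show ?thesis by (simp add: power2_eq_square algebra_simps)
qed

lemma orthogonal_mat_squares_stochastic:
  fixes U :: "real mat"
  assumes U: "U \<in> carrier_mat n n" "transpose_mat U * U = 1\<^sub>m n" and j: "j < n"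
  shows "(\<Sum>i<n. (U $$ (i,j))\<^sup>2) = 1"
proof -
  have "(\<Sum>i<n. (U $$ (i,j))\<^sup>2) = (transpose_mat U * U) $$ (j,j)"
    using U(1) j by (simp add: scalar_prod_def lessThan_atLeast0 power2_eq_square)
  then show ?thesis unfolding U(2) using j by simp
qed

text \<open>As the polynomial splits over the reals, \<open>proots\<close> loses no factor, and
  \<open>eigenvalue_list A\<close> rearranges the roots.\<close>

lemma char_poly_eigenvalue_list:
  assumes "A \<in> carrier_mat n n" "transpose_mat A = A"
  shows "char_poly A = (\<Prod>e\<leftarrow>eigenvalue_list A. [:-e, 1:])"
proof -
  obtain es where es: "char_poly A = (\<Prod>e\<leftarrow>es. [:-e, 1:])"
    using symmetric_mat_char_poly_splits[OF assms] .
  have "proots (\<Prod>e\<leftarrow>es. [:-e, 1:]) = mset es"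
  proof (induction es)
    case (Cons e es)
    have "(\<Prod>e\<leftarrow>es. [:-e, 1:]) \<noteq> 0" by (auto simp: prod_list_zero_iff)
    then show ?case using Cons by (simp add: proots_mult del: mult_pCons_left)
  qed simp
  then have "mset (eigenvalue_list A) = mset es"
    by (simp add: eigenvalue_list_def es)
  then show ?thesis
    unfolding es by (metis mset_map prod_mset_prod_list)
qed

lemma length_eigenvalue_list:
  assumes "A \<in> carrier_mat n n" "transpose_mat A = A"
  shows "length (eigenvalue_list A) = n"
proof -
  have "degree (\<Prod>e\<leftarrow>es. [:-e, 1:]) = length es" for es :: "real list"
    by (rule degree_linear_factors)
  then show ?thesis
    using degree_monic_char_poly[OF assms(1)] char_poly_eigenvalue_list[OF assms] by metis
qed

text \<open>Permuting the coordinates of a vector thus only permutes its sums over tuples.\<close>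

lemma bij_betw_image_tuples:
  assumes "\<pi> permutes {..<n}"
  shows "bij_betw (image \<pi>) (tuples n p) (tuples n p)"
proof (rule bij_betw_byWitness[where f' = "image (inv_into UNIV \<pi>)"])
  have "\<sigma> ` T \<in> tuples n p" if "\<sigma> permutes {..<n}" "T \<in> tuples n p" for \<sigma> T
    using that permutes_imp_bij[OF that(1)] permutes_inj_on[OF that(1), of T]
    by (auto simp: tuples_def card_image bij_betw_def)
  then show "image \<pi> ` tuples n p \<subseteq> tuples n p" "image (inv_into UNIV \<pi>) ` tuples n p \<subseteq> tuples n p"
    using assms permutes_inv[OF assms] by blast+
qed (simp_all add: image_image permutes_inverses[OF assms])

theorem theorem1p5:
  fixes n p k :: nat and A :: "real mat"
  assumes "n \<ge> 2"
    and "A \<in> carrier_mat n n"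
    and "transpose_mat A = A"
    and "p \<in> {1..n}"
    and "1 \<le> k" and "k \<le> n choose p"
    and "tuple_sum (eigenvalue_list A) \<in> garding_cone (tuples n p) k"
  shows "tuple_sum (diag_mat A) \<in> garding_cone (tuples n p) k \<and>
    elem_sym (tuples n p) k (tuple_sum (diag_mat A))
      \<ge> elem_sym (tuples n p) k (tuple_sum (eigenvalue_list A))"
proof -
  let ?I = "tuples n p"
  let ?es = "eigenvalue_list A"
  let ?b = "tuple_sum ?es"
  \<comment> \<open>Dominance pulled back along the linear map from vectors to their sums over
    tuples; linearity carries convexity over.\<close>
  define K where "K = (\<lambda>y. quot_dominates ?I k ?b (\<lambda>T. \<Sum>i\<in>T. y i))"
  have fin: "finite ?I" by (simp add: tuples_def)
  have "K (\<lambda>i. ?es ! i)"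
    using assms(7) by (simp add: K_def quot_dominates_def tuple_sum_def[abs_def])
  obtain U where U: "U \<in> carrier_mat n n" "transpose_mat U * U = 1\<^sub>m n"
    "transpose_mat U * A * U = mat n n (\<lambda>(i,j). if i = j then ?es ! i else 0)"
    using symmetric_mat_diagonalization[OF assms(2,3) char_poly_eigenvalue_list[OF assms(2,3)]]
    by blast
  have UT: "transpose_mat U \<in> carrier_mat n n" using U by simp
  have K_cong: "K z" if "K y" "\<And>i. i < n \<Longrightarrow> y i = z i" for y z
  proof -
    have "(\<Sum>i\<in>T. y i) = (\<Sum>i\<in>T. z i)" if "T \<in> ?I" for T
      using that \<open>\<And>i. i < n \<Longrightarrow> y i = z i\<close> by (intro sum.cong) (auto simp: tuples_def)
    then show ?thesis using \<open>K y\<close> unfolding K_def by (subst (asm) quot_dominates_cong) auto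
  qed
  have "K (\<lambda>i. \<Sum>j<n. (U $$ (i,j))\<^sup>2 * ?es ! j)"
  proof (rule doubly_stochastic_induct[where K = K and n = n and y = "\<lambda>i. ?es ! i"])
    fix y \<pi> assume "K y" and \<pi>: "\<pi> permutes {..<n}"
    have "(\<lambda>T. \<Sum>i\<in>T. y (\<pi> i)) = (\<lambda>T. \<Sum>i\<in>\<pi> ` T. y i)"
      using permutes_inj_on[OF \<pi>] by (simp add: sum.reindex)
    then show "K (\<lambda>i. y (\<pi> i))"
      using \<open>K y\<close> quot_dominates_reindex[OF bij_betw_image_tuples[OF \<pi>], of p k ?b "\<lambda>T. \<Sum>i\<in>T. y i"]
      by (simp add: K_def)
  next
    fix y z and t :: real assume "K y" "K z" "0 \<le> t" "t \<le> 1"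
    then show "K (\<lambda>i. t * y i + (1 - t) * z i)"
      unfolding K_def sum.distrib sum_distrib_left[symmetric]
      by (intro quot_dominates_convex[OF fin])
  next
    \<comment> \<open>Rows of \<open>U\<close> are columns of \<open>transpose_mat U\<close>, which
      is orthogonal too.\<close>
    show "(\<Sum>j<n. (U $$ (i,j))\<^sup>2) = 1" if "i < n" for i
      using orthogonal_mat_squares_stochastic[OF UT _ that] that U(1)
        mat_mult_left_right_inverse[OF UT U(1,2)] by simp
    show "(\<Sum>i<n. (U $$ (i,j))\<^sup>2) = 1" if "j < n" for j
      using orthogonal_mat_squares_stochastic[OF U(1,2) that] .
    show "?es ! i \<le> ?es ! j" if "i \<le> j" "j < n" for i j
      using that length_eigenvalue_list[OF assms(2,3)]
      by (intro sorted_nth_mono) (auto simp: eigenvalue_list_def)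
    show "K z" if "K y" "\<And>i. i < n \<Longrightarrow> y i = z i" for y z
      using that by (rule K_cong)
    show "K (\<lambda>i. ?es ! i)" by fact
  qed simp
  then have "K (\<lambda>i. diag_mat A ! i)"
  proof (rule K_cong)
    show "(\<Sum>j<n. (U $$ (i,j))\<^sup>2 * ?es ! j) = diag_mat A ! i" if "i < n" for i
      using diag_orthogonal_conjugation[OF assms(2) U that] assms(2) that
      by (simp add: diag_mat_def)
  qed
  then have "quot_dominates ?I k ?b (tuple_sum (diag_mat A))"
    by (simp add: K_def tuple_sum_def[abs_def])
  then show ?thesis
    using quot_dominates_elem_sym_le[OF fin assms(7)] by (auto simp: quot_dominates_def)
qed

end
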